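(* Let $\mathcal{H}$ and $\mathcal{K}$ be real or complex Hilbert spaces, let $S$ be a linear operator from $\mathcal{H}$ to $\mathcal{K}$ and $T$ a linear operator from $\mathcal{K}$ to $\mathcal{H}$ (neither assumed densely defined, closed or bounded) such that $S\wedge T$. Assume in addition that $\operatorname{ran}S=\mathcal{K}$ and $\operatorname{ran}T=\mathcal{H}$. Then $S$ and $T$ have everywhere defined bounded inverses, and $S$ and $T$ are adjoint of each other, i.e. both are densely defined, $S^*=T$ and $T^*=S$.
   Context: A linear operator from $\mathcal{H}$ to $\mathcal{K}$ is a linear map defined on a linear subspace $\operatorname{dom} S\subseteq\mathcal{H}$ with values in $\mathcal{K}$; equality of operators includes equality of domains. $S\wedge T$ ("adjoint to each other") means $(Sh\mid k)=(h\mid Tk)$ for all $h\in\operatorname{dom}S$, $k\in\operatorname{dom}T$. *)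

theory Defs
  imports "HOL-Analysis.Analysis"
begin

text \<open>
  Scalars.  A commutative real normed division algebra (with multiplicative norm) is \<open>\<real>\<close> or
  \<open>\<complex>\<close> by the Gelfand-Mazur theorem, so up to isomorphism the only instances are the two below;
  the axioms determine the conjugation uniquely.
\<close>

class real_or_complex = real_normed_field +
  fixes conjg :: "'a \<Rightarrow> 'a"
  assumes conjg_add: "conjg (x + y) = conjg x + conjg y"
    and conjg_mult: "conjg (x * y) = conjg x * conjg y"
    and mult_conjg: "x * conjg x = (norm x)\<^sup>2 *\<^sub>R 1"

instantiation real :: real_or_complex
begin
definition conjg_real :: "real \<Rightarrow> real" where "conjg_real x = x"
instance by standard (simp_all add: conjg_real_def power2_eq_square)
end

instantiation complex :: real_or_complex
begin
definition conjg_complex :: "complex \<Rightarrow> complex" where "conjg_complex = cnj"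
instance by standard (simp_all add: conjg_complex_def complex_norm_square scaleR_conv_of_real
  del: of_real_power)
end

text \<open>
  The Hilbert space is the whole type \<open>'v\<close>.  Its norm, topology and completeness are those of the
  class \<open>banach\<close>, which the scalar multiplication and the inner product have to induce.
  The inner product is linear in the first argument; positive definiteness is part of
  \<open>ip_norm\<close>.
\<close>

locale hilbert_space = vector_space scale
  for scale :: "'f::real_or_complex \<Rightarrow> 'v::banach \<Rightarrow> 'v" +
  fixes ip :: "'v \<Rightarrow> 'v \<Rightarrow> 'f"
  assumes scale_of_real: "scale (of_real r) x = r *\<^sub>R x"
    and ip_add_left: "ip (x + y) z = ip x z + ip y z"
    and ip_scale_left: "ip (scale a x) y = a * ip x y"
    and ip_conjg: "ip y x = conjg (ip x y)"
    and ip_norm: "ip x x = of_real ((norm x)\<^sup>2)"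

lemma hilbert_space_real:
  "hilbert_space (scaleR :: real \<Rightarrow> 'v::{real_inner,banach} \<Rightarrow> 'v) inner"
  by unfold_locales
    (simp_all add: algebra_simps inner_commute conjg_real_def power2_norm_eq_inner)

lemma hilbert_space_complex:
  "hilbert_space ((*) :: complex \<Rightarrow> complex \<Rightarrow> complex) (\<lambda>x y. x * cnj y)"
  by unfold_locales
    (simp_all add: algebra_simps conjg_complex_def complex_norm_square scaleR_conv_of_real
      del: of_real_power)

text \<open>
  Partially defined operators are partial functions \<open>'v \<rightharpoonup> 'w\<close>, so that \<open>dom\<close> and \<open>ran\<close> are
  the library's and \<open>=\<close> on operators includes equality of domains.
\<close>

definition linear_operator ::
  "('f::field \<Rightarrow> 'v::ab_group_add \<Rightarrow> 'v) \<Rightarrow> ('f \<Rightarrow> 'w::ab_group_add \<Rightarrow> 'w) \<Rightarrow> ('v \<rightharpoonup> 'w) \<Rightarrow> bool"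
  where "linear_operator scaleV scaleW A \<longleftrightarrow>
    module.subspace scaleV (dom A) \<and>
    (\<forall>x\<in>dom A. \<forall>y\<in>dom A. the (A (x + y)) = the (A x) + the (A y)) \<and>
    (\<forall>a. \<forall>x\<in>dom A. the (A (scaleV a x)) = scaleW a (the (A x)))"

definition adjoint_to_each_other ::
  "('v \<Rightarrow> 'v \<Rightarrow> 'f) \<Rightarrow> ('w \<Rightarrow> 'w \<Rightarrow> 'f) \<Rightarrow> ('v \<rightharpoonup> 'w) \<Rightarrow> ('w \<rightharpoonup> 'v) \<Rightarrow> bool"
  where "adjoint_to_each_other ipV ipW S T \<longleftrightarrow>
    (\<forall>h\<in>dom S. \<forall>k\<in>dom T. ipW (the (S h)) k = ipV h (the (T k)))"

definition densely_defined :: "('v::topological_space \<rightharpoonup> 'w) \<Rightarrow> bool"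
  where "densely_defined A \<longleftrightarrow> closure (dom A) = UNIV"

text \<open>
  The adjoint \<open>A\<^sup>*\<close>; meaningful only for densely defined \<open>A\<close>, where the vector \<open>h'\<close> is unique.
\<close>

definition adjoint_op ::
  "('v \<Rightarrow> 'v \<Rightarrow> 'f) \<Rightarrow> ('w \<Rightarrow> 'w \<Rightarrow> 'f) \<Rightarrow> ('v \<rightharpoonup> 'w) \<Rightarrow> ('w \<rightharpoonup> 'v)"
  where "adjoint_op ipV ipW A = (\<lambda>k.
    if \<exists>h'. \<forall>h\<in>dom A. ipW (the (A h)) k = ipV h h'
    then Some (THE h'. \<forall>h\<in>dom A. ipW (the (A h)) k = ipV h h')
    else None)"

text \<open>The inverse operator, with domain \<open>ran A\<close>; meaningful only for injective \<open>A\<close>.\<close>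

definition inverse_op :: "('v \<rightharpoonup> 'w) \<Rightarrow> ('w \<rightharpoonup> 'v)"
  where "inverse_op A = (\<lambda>k. if k \<in> ran A then Some (THE h. A h = Some k) else None)"

definition bounded_operator ::
  "('f::field \<Rightarrow> 'v::real_normed_vector \<Rightarrow> 'v) \<Rightarrow> ('f \<Rightarrow> 'w::real_normed_vector \<Rightarrow> 'w) \<Rightarrow>
    ('v \<rightharpoonup> 'w) \<Rightarrow> bool"
  where "bounded_operator scaleV scaleW A \<longleftrightarrow>
    linear_operator scaleV scaleW A \<and> (\<exists>C. \<forall>x\<in>dom A. norm (the (A x)) \<le> C * norm x)"

definition has_everywhere_defined_bounded_inverse ::
  "('f::field \<Rightarrow> 'v::real_normed_vector \<Rightarrow> 'v) \<Rightarrow> ('f \<Rightarrow> 'w::real_normed_vector \<Rightarrow> 'w) \<Rightarrow>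
    ('v \<rightharpoonup> 'w) \<Rightarrow> bool"
  where "has_everywhere_defined_bounded_inverse scaleV scaleW A \<longleftrightarrow>
    inj_on A (dom A) \<and> dom (inverse_op A) = UNIV \<and>
    bounded_operator scaleW scaleV (inverse_op A)"

end

theory Submission
  imports Defs
begin

text \<open>
  Surjectivity of \<open>T\<close> makes \<open>S\<close> injective and vice versa, and the total inverses \<open>A\<close> of \<open>S\<close> and
  \<open>B\<close> of \<open>T\<close> satisfy \<open>(A y | x) = (y | B x)\<close>; by Hellinger-Toeplitz they are bounded.  A vector \<open>z\<close>
  orthogonal to \<open>dom S = range A\<close> has \<open>B z = 0\<close>, so \<open>z = T 0 = 0\<close>, and the closest point argument
  gives density.  Finally, if \<open>(S h | k) = (h | x)\<close> on \<open>dom S\<close>, then comparing with the preimage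
  \<open>B x\<close> of \<open>x\<close> under \<open>T\<close> and using \<open>ran S = K\<close> gives \<open>k = B x\<close>, i.e. \<open>T k = x\<close>.
\<close>

section \<open>Conjugation of scalars and inner product algebra\<close>

lemma conjg_of_real [simp]: "conjg (of_real r :: 'a::real_or_complex) = of_real r"
proof (cases "r = 0")
  case True
  \<comment> \<open>At \<open>0\<close> the law \<open>mult_conjg\<close> leaves nothing to cancel,
    so additivity settles this value.\<close>
  have "conjg (0::'a) + conjg 0 = conjg 0"
    by (metis add_0 conjg_add)
  with True show ?thesis
    by simp
next
  case False
  have "of_real r * conjg (of_real r :: 'a) = of_real r * of_real r"
    by (simp add: mult_conjg scaleR_conv_of_real power2_eq_square)
  with False show ?thesis
    by simp
qed

lemma mult_conjg': "x * conjg x = (of_real ((norm x)\<^sup>2) :: 'a::real_or_complex)"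
  by (simp only: mult_conjg scaleR_conv_of_real mult_1_right)

context hilbert_space
begin

lemma ip_add_right: "ip z (x + y) = ip z x + ip z y"
  by (metis ip_conjg ip_add_left conjg_add)

lemma ip_scale_right: "ip x (scale a y) = conjg a * ip x y"
  by (metis ip_conjg ip_scale_left conjg_mult)

lemma ip_zero_left [simp]: "ip 0 z = 0"
  using ip_add_left[of 0 0 z] by simp

lemma ip_zero_right [simp]: "ip z 0 = 0"
  using ip_add_right[of z 0 0] by simp

lemma ip_minus_left: "ip (- x) z = - ip x z"
  using ip_add_left[of "- x" x z] by (simp add: eq_neg_iff_add_eq_0)

lemma ip_minus_right: "ip z (- x) = - ip z x"
  using ip_add_right[of z "- x" x] by (simp add: eq_neg_iff_add_eq_0)

lemma ip_diff_left: "ip (x - y) z = ip x z - ip y z"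
  using ip_add_left[of x "- y" z] by (simp add: ip_minus_left)

lemma ip_diff_right: "ip z (x - y) = ip z x - ip z y"
  using ip_add_right[of z x "- y"] by (simp add: ip_minus_right)

lemma ip_self_eq_0_iff [simp]: "ip x x = 0 \<longleftrightarrow> x = 0"
  by (simp add: ip_norm)

lemma ip_eqI: "(\<And>z. ip x z = ip y z) \<Longrightarrow> x = y"
  using ip_self_eq_0_iff[of "x - y"] by (simp add: ip_diff_left)

lemma parallelogram_law:
  fixes x y :: 'v
  shows
  "(norm (x + y))\<^sup>2 + (norm (x - y))\<^sup>2 = 2 * (norm x)\<^sup>2 + 2 * (norm y)\<^sup>2"
proof -
  have "ip (x + y) (x + y) + ip (x - y) (x - y) = 2 * ip x x + 2 * ip y y"
    by (simp add: ip_add_left ip_add_right ip_diff_left ip_diff_right)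
  then have "(of_real ((norm (x + y))\<^sup>2 + (norm (x - y))\<^sup>2) :: 'f) =
      of_real (2 * (norm x)\<^sup>2 + 2 * (norm y)\<^sup>2)"
    by (simp add: ip_norm)
  then show ?thesis
    by (simp only: of_real_eq_iff)
qed

text \<open>Pythagoras: \<open>scale a u\<close> is the orthogonal projection of \<open>z\<close>
  onto the line through \<open>u\<close>. Nonnegativity of the left side yields Cauchy-Schwarz, and
  minimality of a distance yields orthogonality.\<close>

lemma norm_sub_projection:
  fixes z u :: 'v
  assumes "u \<noteq> 0"
  defines "a \<equiv> ip z u / of_real ((norm u)\<^sup>2)"
  shows "(norm (z - scale a u))\<^sup>2 = (norm z)\<^sup>2 - (norm (ip z u))\<^sup>2 / (norm u)\<^sup>2"
proof -
  have a: "a * of_real ((norm u)\<^sup>2) = ip z u"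
    using assms by simp
  have "ip (z - scale a u) (z - scale a u) =
      ip z z - conjg a * ip z u - a * ip u z + a * conjg a * ip u u"
    by (simp add: ip_diff_left ip_diff_right ip_scale_left ip_scale_right algebra_simps)
  also have "a * conjg a * ip u u = conjg a * ip z u"
    using a by (simp add: ip_norm mult_ac)
  also have "a * ip u z = of_real ((norm (ip z u))\<^sup>2 / (norm u)\<^sup>2)"
    by (simp add: a_def ip_conjg[of u z] mult_conjg' del: of_real_power)
  finally have "(of_real ((norm (z - scale a u))\<^sup>2) :: 'f) =
      of_real ((norm z)\<^sup>2 - (norm (ip z u))\<^sup>2 / (norm u)\<^sup>2)"
    by (simp add: ip_norm)
  then show ?thesis
    by (simp only: of_real_eq_iff)
qed

lemma Cauchy_Schwarz: "norm (ip z u) \<le> norm z * norm u"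
proof (cases "u = 0")
  case False
  have "0 \<le> (norm z)\<^sup>2 - (norm (ip z u))\<^sup>2 / (norm u)\<^sup>2"
    using norm_sub_projection[OF False, of z] by (metis zero_le_power2)
  with False have "(norm (ip z u))\<^sup>2 \<le> (norm z * norm u)\<^sup>2"
    by (simp add: field_simps power_mult_distrib)
  then show ?thesis
    by (rule power2_le_imp_le) simp
qed simp

text \<open>Cauchy-Schwarz in one direction, \<open>z = x\<close> in the other. A bound on a norm
  thus becomes a family of bounds on scalars.\<close>

lemma norm_le_iff_ip:
  assumes "0 \<le> c"
  shows "norm x \<le> c \<longleftrightarrow> (\<forall>z. norm (ip x z) \<le> c * norm z)"
proof
  show "norm x \<le> c \<Longrightarrow> \<forall>z. norm (ip x z) \<le> c * norm z"
    using Cauchy_Schwarz by (meson mult_right_mono norm_ge_zero order_trans)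
next
  assume "\<forall>z. norm (ip x z) \<le> c * norm z"
  then have "norm (ip x x) \<le> c * norm x"
    by blast
  then show "norm x \<le> c"
    using assms by (cases "x = 0") (simp_all add: ip_norm norm_power power2_eq_square norm_mult)
qed

lemma bounded_linear_ip_left: "bounded_linear (\<lambda>x. ip x z)"
proof
  show "ip (x + y) z = ip x z + ip y z" for x y
    by (rule ip_add_left)
  show "ip (r *\<^sub>R x) z = r *\<^sub>R ip x z" for r x
    by (metis scale_of_real ip_scale_left scaleR_conv_of_real)
  show "\<exists>C. \<forall>x. norm (ip x z) \<le> norm x * C"
    using Cauchy_Schwarz by blast
qed

section \<open>Closest points and density\<close>

text \<open>A minimising sequence in \<open>M\<close> is Cauchy by the parallelogram law, and
  \<open>m\<close> is its limit. As \<open>m\<close> may lie outside \<open>M\<close>, minimality is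
  stated for shifts of \<open>m\<close> by multiples of vectors of \<open>M\<close>.\<close>

lemma closest_point_of_closure:
  fixes x :: 'v
  assumes "subspace M"
  obtains m where "m \<in> closure M" "\<And>u a. u \<in> M \<Longrightarrow> norm (x - m) \<le> norm (x - m - scale a u)"
proof -
  define d where "d = (INF m\<in>M. (norm (x - m))\<^sup>2)"
  have ne: "M \<noteq> {}"
    using subspace_0[OF assms] by blast
  have bdd: "bdd_below ((\<lambda>m. (norm (x - m))\<^sup>2) ` M)"
    by (rule bdd_belowI[of _ 0]) auto
  have d_le: "d \<le> (norm (x - m))\<^sup>2" if "m \<in> M" for m
    unfolding d_def using bdd that by (rule cINF_lower)
  have "\<exists>m\<in>M. (norm (x - m))\<^sup>2 < d + 1 / real (Suc n)" for n
    using cINF_less_iff[OF ne bdd, of "d + 1 / real (Suc n)"] by (simp add: d_def)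
  then obtain s where sM: "\<And>n. s n \<in> M"
    and s: "\<And>n. (norm (x - s n))\<^sup>2 < d + 1 / real (Suc n)"
    by metis
  have s_diff: "(norm (s i - s j))\<^sup>2 \<le> 2 / real (Suc i) + 2 / real (Suc j)" for i j
  proof -
    \<comment> \<open>The midpoint is again a competitor, so its squared distance from
      \<open>x\<close> is at least \<open>d\<close>. In the parallelogram law this cancels
      \<open>4 * d\<close> and leaves only the errors of \<open>s i\<close> and
      \<open>s j\<close>.\<close>
    have half: "(1/2) *\<^sub>R (s i + s j) \<in> M"
      using subspace_scale[OF assms subspace_add[OF assms sM sM], of "of_real (1/2)"]
      by (simp only: scale_of_real)
    have "(x - s i) + (x - s j) = 2 *\<^sub>R (x - (1/2) *\<^sub>R (s i + s j))"
      by (simp add: algebra_simps scaleR_2)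
    then have "(norm ((x - s i) + (x - s j)))\<^sup>2 = 4 * (norm (x - (1/2) *\<^sub>R (s i + s j)))\<^sup>2"
      by (simp add: power_mult_distrib)
    then have "(norm (s i - s j))\<^sup>2 \<le> 2 * (norm (x - s i))\<^sup>2 + 2 * (norm (x - s j))\<^sup>2 - 4 * d"
      using parallelogram_law[of "x - s i" "x - s j"] d_le[OF half]
      by (simp add: norm_minus_commute)
    then show ?thesis
      using s[of i] s[of j] by simp
  qed
  have "Cauchy s"
  proof (rule metric_CauchyI)
    fix e :: real
    assume "0 < e"
    \<comment> \<open>Beyond \<open>N\<close>, the bound \<open>s_diff\<close> is at most
      \<open>4 / real (Suc N)\<close>, hence below \<open>e\<^sup>2\<close>.\<close>
    then obtain N where N: "1 / real (Suc N) < e\<^sup>2 / 4"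
      using nat_approx_posE[of "e\<^sup>2 / 4"] by auto
    have "dist (s i) (s j) < e" if "N \<le> i" "N \<le> j" for i j
    proof -
      have "1 / real (Suc i) \<le> 1 / real (Suc N)" "1 / real (Suc j) \<le> 1 / real (Suc N)"
        using that by (simp_all add: frac_le)
      then have "(norm (s i - s j))\<^sup>2 < e\<^sup>2"
        using s_diff[of i j] N by simp
      then show ?thesis
        using \<open>0 < e\<close> by (simp add: dist_norm power2_less_imp_less)
    qed
    then show "\<exists>N. \<forall>i\<ge>N. \<forall>j\<ge>N. dist (s i) (s j) < e"
      by blast
  qed
  then obtain m where m: "s \<longlonglongrightarrow> m"
    using Cauchy_convergent convergent_def by blast
  show thesis
  proof
    show "m \<in> closure M"
      using sM m by (auto simp: closure_sequential)
  next
    fix u a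
    assume "u \<in> M"
    have "d \<le> (norm (x - m - scale a u))\<^sup>2"
    proof (rule LIMSEQ_le_const)
      show "(\<lambda>n. (norm (x - s n - scale a u))\<^sup>2) \<longlonglongrightarrow> (norm (x - m - scale a u))\<^sup>2"
        by (intro tendsto_intros m)
      have "s n + scale a u \<in> M" for n
        using assms sM \<open>u \<in> M\<close> by (simp add: subspace_add subspace_scale)
      then show "\<exists>N. \<forall>n\<ge>N. d \<le> (norm (x - s n - scale a u))\<^sup>2"
        using d_le by (metis diff_diff_add)
    qed
    moreover have "(norm (x - m))\<^sup>2 \<le> d + 0"
    proof (rule LIMSEQ_le)
      show "(\<lambda>n. (norm (x - s n))\<^sup>2) \<longlonglongrightarrow> (norm (x - m))\<^sup>2"
        by (intro tendsto_intros m)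
      show "(\<lambda>n. d + 1 / real (Suc n)) \<longlonglongrightarrow> d + 0"
        by (intro tendsto_intros LIMSEQ_Suc[OF lim_1_over_n])
      show "\<exists>N. \<forall>n\<ge>N. (norm (x - s n))\<^sup>2 \<le> d + 1 / real (Suc n)"
        using s less_imp_le by blast
    qed
    ultimately show "norm (x - m) \<le> norm (x - m - scale a u)"
      by (simp add: power2_le_imp_le)
  qed
qed

lemma dense_if_orthogonal_trivial:
  assumes "subspace M" and triv: "\<And>z. (\<And>u. u \<in> M \<Longrightarrow> ip z u = 0) \<Longrightarrow> z = 0"
  shows "closure M = UNIV"
proof -
  have "x \<in> closure M" for x
  proof -
    obtain m where m: "m \<in> closure M"
      and min: "\<And>u a. u \<in> M \<Longrightarrow> norm (x - m) \<le> norm (x - m - scale a u)"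
      using closest_point_of_closure[OF assms(1), of x] by blast
    have "ip (x - m) u = 0" if "u \<in> M" for u
    proof (cases "u = 0")
      case False
      \<comment> \<open>Minimality is applied with \<open>a\<close> the projection coefficient of
        \<open>x - m\<close> along \<open>u\<close>.\<close>
      have "(norm (x - m))\<^sup>2 \<le> (norm (x - m))\<^sup>2 - (norm (ip (x - m) u))\<^sup>2 / (norm u)\<^sup>2"
        using min[OF that] norm_sub_projection[OF False, of "x - m"]
        by (metis norm_ge_zero power_mono)
      then have "(norm (ip (x - m) u))\<^sup>2 / (norm u)\<^sup>2 \<le> 0"
        by linarith
      with False show ?thesis
        by (simp add: divide_le_0_iff)
    qed simp
    then show ?thesis
      using triv[of "x - m"] m by simp
  qed
  then show ?thesis
    by blast
qed

end

section \<open>Boundedness by Baire category\<close>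

text \<open>The sublevel sets form a countable closed cover of a complete space, so by Baire one of
  them contains a ball; linearity moves the bound to the origin and rescales it.\<close>

lemma bounded_linear_if_closed_sublevels:
  fixes A :: "'a::banach \<Rightarrow> 'b::real_normed_vector"
  assumes "linear A" and closed: "\<And>n::nat. closed {y. norm (A y) \<le> real n}"
  shows "bounded_linear A"
proof -
  interpret linear A by fact
  have "\<exists>n::nat. interior {y. norm (A y) \<le> real n} \<noteq> {}"
  proof (rule ccontr)
    assume "\<not> ?thesis"
    then have "euclidean interior_of (\<Union>(range (\<lambda>n::nat. {y. norm (A y) \<le> real n}))) = {}"
      using closed
      by (intro Baire_category_alt disjI1 completely_metrizable_space_euclidean) auto
    moreover have "(\<Union>(range (\<lambda>n::nat. {y. norm (A y) \<le> real n}))) = UNIV"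
      using real_arch_simple by auto
    ultimately show False
      by simp
  qed
  then obtain n y0 where "y0 \<in> interior {y. norm (A y) \<le> real n}"
    by blast
  then obtain e where "0 < e" and "cball y0 e \<subseteq> {y. norm (A y) \<le> real n}"
    unfolding mem_interior_cball by blast
  then have n: "norm (A (y0 + z)) \<le> real n" if "norm z \<le> e" for z
    using that by (force simp: dist_norm)
  have "norm (A y) \<le> norm y * (2 * real n / e)" for y
  proof (cases "y = 0")
    case False
    \<comment> \<open>With this factor \<open>t *\<^sub>R y\<close> has norm \<open>e\<close>. Its
      image is the difference of the values at two points of the ball, which costs the bound
      \<open>n\<close> twice.\<close>
    define t where "t = e / norm y"
    have "0 < t"
      using False \<open>0 < e\<close> by (simp add: t_def)
    have "t * norm (A y) = norm (A (y0 + t *\<^sub>R y) - A (y0 + 0))"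
      using \<open>0 < t\<close> by (simp add: add scale)
    also have "\<dots> \<le> real n + real n"
      using False \<open>0 < e\<close>
      by (intro order_trans[OF norm_triangle_ineq4] add_mono n) (simp_all add: t_def)
    finally show ?thesis
      using False \<open>0 < e\<close> by (simp add: t_def field_simps)
  qed (simp add: zero)
  then show ?thesis
    by unfold_locales blast
qed

text \<open>Total maps with a formal adjoint. Linearity of \<open>A\<close> follows from
  \<open>adj\<close>, because inner products separate points.\<close>

locale adjoint_maps = V: hilbert_space scaleV ipV + W: hilbert_space scaleW ipW
  for scaleV :: "'f::real_or_complex \<Rightarrow> 'v::banach \<Rightarrow> 'v" and ipV
    and scaleW :: "'f \<Rightarrow> 'w::banach \<Rightarrow> 'w" and ipW +
  fixes A :: "'w \<Rightarrow> 'v" and B :: "'v \<Rightarrow> 'w"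
  assumes adj: "ipV (A y) x = ipW y (B x)"
begin

lemma map_add: "A (x + y) = A x + A y"
  by (rule V.ip_eqI) (simp add: adj W.ip_add_left V.ip_add_left)

lemma map_scale: "A (scaleW a x) = scaleV a (A x)"
  by (rule V.ip_eqI) (simp add: adj W.ip_scale_left V.ip_scale_left)

theorem Hellinger_Toeplitz: "bounded_linear A"
proof (rule bounded_linear_if_closed_sublevels)
  show "linear A"
    by (rule linearI)
      (simp_all add: map_add map_scale flip: V.scale_of_real W.scale_of_real)
  \<comment> \<open>The continuity of \<open>A\<close> is not yet known, so closedness has to come from that of \<open>ipW\<close>.\<close>
  have "{y. norm (A y) \<le> real n} = (\<Inter>x. {y. norm (ipW y (B x)) \<le> real n * norm x})" for n
    by (auto simp: V.norm_le_iff_ip adj)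
  moreover have "closed {y. norm (ipW y (B x)) \<le> real n * norm x}" for n x
    by (intro closed_Collect_le continuous_intros
        bounded_linear.continuous_on[OF W.bounded_linear_ip_left])
  ultimately show "closed {y. norm (A y) \<le> real n}" for n
    by auto
qed

end

section \<open>Surjective operators adjoint to each other\<close>

locale surjective_adjoint_pair = H: hilbert_space scaleH ipH + K: hilbert_space scaleK ipK
  for scaleH :: "'f::real_or_complex \<Rightarrow> 'h::banach \<Rightarrow> 'h" and ipH
    and scaleK :: "'f \<Rightarrow> 'k::banach \<Rightarrow> 'k" and ipK +
  fixes S :: "'h \<rightharpoonup> 'k" and T :: "'k \<rightharpoonup> 'h"
  assumes linear_S: "linear_operator scaleH scaleK S"
    and linear_T: "linear_operator scaleK scaleH T"
    and adjoint: "adjoint_to_each_other ipH ipK S T"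
    and ran_S: "ran S = UNIV"
    and ran_T: "ran T = UNIV"
begin

lemma adjointD: "S h = Some y \<Longrightarrow> T k = Some x \<Longrightarrow> ipK y k = ipH h x"
  using adjoint unfolding adjoint_to_each_other_def by force

text \<open>The hypotheses are symmetric up to conjugation, so each result about \<open>S\<close>
  also serves for \<open>T\<close>.\<close>

lemma flip: "surjective_adjoint_pair scaleK ipK scaleH ipH T S"
proof unfold_locales
  show "adjoint_to_each_other ipK ipH T S"
    unfolding adjoint_to_each_other_def
  proof (intro ballI)
    fix k h
    assume "k \<in> dom T" "h \<in> dom S"
    then have "ipK (the (S h)) k = ipH h (the (T k))"
      by (auto intro: adjointD)
    then show "ipH (the (T k)) h = ipK k (the (S h))"
      by (metis H.ip_conjg K.ip_conjg)
  qed
qed (fact linear_S linear_T ran_S ran_T)+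

lemma surj: obtains h where "S h = Some y"
  using ran_S unfolding ran_def by blast

text \<open>Every \<open>z\<close> has the form \<open>T k\<close>, and both inner products with
  \<open>z\<close> equal \<open>ipK y k\<close>.\<close>

lemma unique_preimage:
  assumes "S h = Some y" "S h' = Some y"
  shows "h = h'"
proof (rule H.ip_eqI)
  fix z
  interpret TS: surjective_adjoint_pair scaleK ipK scaleH ipH T S
    by (rule flip)
  obtain k where "T k = Some z"
    by (rule TS.surj)
  with assms show "ipH h z = ipH h' z"
    by (metis adjointD)
qed

text \<open>Total, unlike \<open>inverse_op S\<close>, so that \<open>adjoint_maps\<close> can be
  instantiated with it.\<close>

definition inv_S :: "'k \<Rightarrow> 'h" where "inv_S y = (THE h. S h = Some y)"

lemma S_inv_S: "S (inv_S y) = Some y"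
proof -
  obtain h where "S h = Some y"
    by (rule surj)
  then show ?thesis
    unfolding inv_S_def by (rule theI) (rule unique_preimage[OF _ \<open>S h = Some y\<close>])
qed

lemma inv_S_dom: "inv_S y \<in> dom S"
  using S_inv_S by blast

lemma inverse_op_S: "inverse_op S = (\<lambda>y. Some (inv_S y))"
  by (simp add: inverse_op_def ran_S inv_S_def)

lemma inj_S: "inj_on S (dom S)"
proof (rule inj_onI)
  fix x y
  assume "x \<in> dom S" "S x = S y"
  then show "x = y"
    using unique_preimage by (metis domD)
qed

lemma orthogonal_dom_S:
  assumes "\<And>h. h \<in> dom S \<Longrightarrow> ipH h z = 0"
  shows "z = 0"
proof -
  interpret TS: surjective_adjoint_pair scaleK ipK scaleH ipH T S
    by (rule flip)
  have z: "T (TS.inv_S z) = Some z"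
    by (rule TS.S_inv_S)
  have "ipK y (TS.inv_S z) = ipK y 0" for y
    using adjointD[OF S_inv_S z, of y] assms[OF inv_S_dom] by simp
  then have "TS.inv_S z = 0"
    by (metis K.ip_self_eq_0_iff K.ip_zero_right)
  with z have T0: "T 0 = Some z"
    by simp
  \<comment> \<open>Additivity forces the value of \<open>T\<close> at \<open>0\<close> to be
    \<open>0\<close>, and that value is \<open>z\<close>.\<close>
  have "the (T (0 + 0)) = the (T 0) + the (T 0)"
    using linear_T domI[of T, OF T0] unfolding linear_operator_def by blast
  with T0 show ?thesis
    by simp
qed

lemma densely_defined_S: "densely_defined S"
  unfolding densely_defined_def
proof (rule H.dense_if_orthogonal_trivial)
  show "H.subspace (dom S)"
    using linear_S unfolding linear_operator_def by blast
  show "z = 0" if "\<And>u. u \<in> dom S \<Longrightarrow> ipH z u = 0" for z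
  proof (rule orthogonal_dom_S)
    show "ipH h z = 0" if "h \<in> dom S" for h
      using that \<open>\<And>u. u \<in> dom S \<Longrightarrow> ipH z u = 0\<close> H.ip_conjg[of h z]
      by (metis conjg_of_real of_real_0)
  qed
qed

text \<open>Both linearity and boundedness of the inverse come from its adjoint relation to the
  inverse of \<open>T\<close>.\<close>

lemma bounded_inverse_S: "has_everywhere_defined_bounded_inverse scaleH scaleK S"
proof -
  interpret TS: surjective_adjoint_pair scaleK ipK scaleH ipH T S
    by (rule flip)
  interpret A: adjoint_maps scaleH ipH scaleK ipK inv_S TS.inv_S
    by unfold_locales (simp add: adjointD[OF S_inv_S TS.S_inv_S])
  have "\<exists>C. \<forall>y. norm (inv_S y) \<le> C * norm y"
    using bounded_linear.bounded[OF A.Hellinger_Toeplitz] by (metis mult.commute)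
  moreover have "dom (inverse_op S) = UNIV"
    by (auto simp: inverse_op_S)
  ultimately show ?thesis
    unfolding has_everywhere_defined_bounded_inverse_def bounded_operator_def linear_operator_def
    by (simp add: inj_S inverse_op_S A.map_add A.map_scale)
qed

lemma adjoint_op_S: "adjoint_op ipH ipK S = T"
proof
  fix k
  \<comment> \<open>Both the existence test and the description in \<open>adjoint_op\<close> use
    this predicate, so the equivalence settles domains and values at once.\<close>
  have char: "(\<forall>h\<in>dom S. ipK (the (S h)) k = ipH h x) \<longleftrightarrow> T k = Some x" for x
  proof
    assume x: "\<forall>h\<in>dom S. ipK (the (S h)) k = ipH h x"
    interpret TS: surjective_adjoint_pair scaleK ipK scaleH ipH T S
      by (rule flip)
    have "ipK y k = ipK y (TS.inv_S x)" for y
      using x S_inv_S[of y] adjointD[OF S_inv_S TS.S_inv_S] by (metis inv_S_dom option.sel)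
    then have "k = TS.inv_S x"
      by (intro K.ip_eqI) (metis K.ip_conjg)
    then show "T k = Some x"
      by (simp add: TS.S_inv_S)
  qed (auto intro: adjointD)
  show "adjoint_op ipH ipK S k = T k"
    unfolding adjoint_op_def char by (cases "T k") auto
qed

end

theorem theorem3p3:
  fixes scaleH :: "'f::real_or_complex \<Rightarrow> 'h::banach \<Rightarrow> 'h" and ipH :: "'h \<Rightarrow> 'h \<Rightarrow> 'f"
    and scaleK :: "'f \<Rightarrow> 'k::banach \<Rightarrow> 'k" and ipK :: "'k \<Rightarrow> 'k \<Rightarrow> 'f"
    and S :: "'h \<rightharpoonup> 'k" and T :: "'k \<rightharpoonup> 'h"
  assumes "hilbert_space scaleH ipH"
    and "hilbert_space scaleK ipK"
    and "linear_operator scaleH scaleK S"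
    and "linear_operator scaleK scaleH T"
    and "adjoint_to_each_other ipH ipK S T"
    and "ran S = UNIV"
    and "ran T = UNIV"
  shows "has_everywhere_defined_bounded_inverse scaleH scaleK S \<and>
    has_everywhere_defined_bounded_inverse scaleK scaleH T \<and>
    densely_defined S \<and> densely_defined T \<and>
    adjoint_op ipH ipK S = T \<and> adjoint_op ipK ipH T = S"
proof -
  interpret ST: surjective_adjoint_pair scaleH ipH scaleK ipK S T
    using assms by (simp add: surjective_adjoint_pair_def surjective_adjoint_pair_axioms_def)
  interpret TS: surjective_adjoint_pair scaleK ipK scaleH ipH T S
    by (rule ST.flip)
  show ?thesis
    by (simp add: ST.bounded_inverse_S TS.bounded_inverse_S ST.densely_defined_S
        TS.densely_defined_S ST.adjoint_op_S TS.adjoint_op_S)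
qed

end
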